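(* Let $(A,\to,\rightsquigarrow,0,1)$ be a bounded commutative pseudo BE-algebra. There is a one-to-one correspondence between the universal quantifiers on $A$ and the existential quantifiers on $A$. If $\forall$ is a universal quantifier on $A$, then the corresponding existential quantifier $\exists$ is given by $\exists x=(\forall (x^{-}))^{\sim}=(\forall (x^{\sim}))^{-}$ for all $x\in A$. Dually, if $\exists$ is an existential quantifier on $A$, then the corresponding universal quantifier $\forall$ is given by $\forall x=(\exists (x^{-}))^{\sim}=(\exists (x^{\sim}))^{-}$ for all $x\in A$.
   Context: A pseudo BE-algebra is an algebra $(A,\to,\rightsquigarrow,1)$ of type $(2,2,0)$ such that for all $x,y,z\in A$: $x\to x=x\rightsquigarrow x=1$; $x\to 1=x\rightsquigarrow 1=1$; $1\to x=1\rightsquigarrow x=x$; $x\to(y\rightsquigarrow z)=y\rightsquigarrow(x\to z)$; and $x\to y=1$ iff $x\rightsquigarrow y=1$. One writes $x\le y$ iff $x\to y=1$ (equivalently $x\rightsquigarrow y=1$). It is commutative if $(x\to y)\rightsquigarrow y=(y\to x)\rightsquigarrow x$ and $(x\rightsquigarrow y)\to y=(y\rightsquigarrow x)\to x$ for all $x,y$. It is bounded if it has an element $0$ with $0\le x$ for all $x$; then $x^{-}=x\to 0$ and $x^{\sim}=x\rightsquigarrow 0$. In a bounded commutative pseudo BE-algebra, $\le$ is a partial order, $x^{-\sim}=x^{\sim-}=x$, and one sets $x\oplus y=y^{\sim}\to x=x^{-}\rightsquigarrow y$ and $x\odot y=(x\to y^{-})^{\sim}=(y\rightsquigarrow x^{\sim})^{-}$.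 A monadic bounded commutative pseudo BE-algebra $(A,\exists,\forall)$ is a bounded commutative pseudo BE-algebra with maps $\exists,\forall:A\to A$ such that for all $x,y\in A$: (M1) $x\to\exists x=x\rightsquigarrow\exists x=1$; (M2) $\forall x\to x=\forall x\rightsquigarrow x=1$; (M3) $\forall(x\to\exists y)=\exists x\to\exists y$ and $\forall(x\rightsquigarrow\exists y)=\exists x\rightsquigarrow\exists y$; (M4) $\forall(\exists x\to y)=\exists x\to\forall y$ and $\forall(\exists x\rightsquigarrow y)=\exists x\rightsquigarrow\forall y$; (M5) $\exists\forall x=\forall x$; (M6) $\forall(x\odot x)=\forall x\odot\forall x$; (M7) $\forall(x\oplus x)=\forall x\oplus\forall x$. A map $\forall:A\to A$ is a universal quantifier on $A$ if there is a map $\exists$ such that $(A,\exists,\forall)$ is a monadic bounded commutative pseudo BE-algebra; a map $\exists:A\to A$ is an existential quantifier on $A$ if there is a map $\forall$ such that $(A,\exists,\forall)$ is a monadic bounded commutative pseudo BE-algebra. "Corresponding" means that the pair $(A,\exists,\forall)$ is a monadic bounded commutative pseudo BE-algebra. *)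

theory Defs
  imports Main
begin

text \<open>The carrier is an entire type, so that maps on the algebra are exactly the functions
  of type \<^typ>\<open>'a \<Rightarrow> 'a\<close> and two quantifiers are equal iff they agree at every element.\<close>

locale pseudo_BE =
  fixes imp1 :: "'a \<Rightarrow> 'a \<Rightarrow> 'a"  (infixr \<open>\<rightarrow>\<close> 60)
    and imp2 :: "'a \<Rightarrow> 'a \<Rightarrow> 'a"  (infixr \<open>\<leadsto>\<close> 60)
    and one :: 'a  (\<open>\<one>\<close>)
  assumes imp1_self: "x \<rightarrow> x = \<one>"
    and imp2_self: "x \<leadsto> x = \<one>"
    and imp1_one: "x \<rightarrow> \<one> = \<one>"
    and imp2_one: "x \<leadsto> \<one> = \<one>"
    and one_imp1: "\<one> \<rightarrow> x = x"
    and one_imp2: "\<one> \<leadsto> x = x"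
    and exchange: "x \<rightarrow> (y \<leadsto> z) = y \<leadsto> (x \<rightarrow> z)"
    and imp_one_iff: "x \<rightarrow> y = \<one> \<longleftrightarrow> x \<leadsto> y = \<one>"
begin

definition le :: "'a \<Rightarrow> 'a \<Rightarrow> bool"  (infix \<open>\<preceq>\<close> 50)
  where "x \<preceq> y \<longleftrightarrow> x \<rightarrow> y = \<one>"

end

locale commutative_pseudo_BE = pseudo_BE +
  assumes comm1: "(x \<rightarrow> y) \<leadsto> y = (y \<rightarrow> x) \<leadsto> x"
    and comm2: "(x \<leadsto> y) \<rightarrow> y = (y \<leadsto> x) \<rightarrow> x"

locale bounded_commutative_pseudo_BE = commutative_pseudo_BE +
  fixes zero :: 'a  (\<open>\<zero>\<close>)
  assumes zero_le: "\<zero> \<preceq> x"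
begin

abbreviation neg1 :: "'a \<Rightarrow> 'a"  (\<open>_\<^sup>-\<close> [1000] 999)
  where "x\<^sup>- \<equiv> x \<rightarrow> \<zero>"

abbreviation neg2 :: "'a \<Rightarrow> 'a"  (\<open>_\<^sup>~\<close> [1000] 999)
  where "x\<^sup>~ \<equiv> x \<leadsto> \<zero>"

definition oplus :: "'a \<Rightarrow> 'a \<Rightarrow> 'a"  (infixl \<open>\<oplus>\<close> 65)
  where "x \<oplus> y = y\<^sup>~ \<rightarrow> x"

definition odot :: "'a \<Rightarrow> 'a \<Rightarrow> 'a"  (infixl \<open>\<odot>\<close> 70)
  where "x \<odot> y = (x \<rightarrow> y\<^sup>-)\<^sup>~"

lemma le_antisym: "x \<preceq> y \<Longrightarrow> y \<preceq> x \<Longrightarrow> x = y"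
  by (metis comm1 le_def one_imp2)

lemma neg1_neg2: "(x\<^sup>-)\<^sup>~ = x"
  by (metis comm1 le_def one_imp2 zero_le)

lemma neg2_neg1: "(x\<^sup>~)\<^sup>- = x"
  by (metis comm2 imp_one_iff le_def one_imp1 zero_le)

lemma oplus_alt: "x \<oplus> y = x\<^sup>- \<leadsto> y"
  by (metis exchange neg1_neg2 neg2_neg1 oplus_def)

lemma contrapos1: "x \<rightarrow> y = y\<^sup>- \<leadsto> x\<^sup>-"
  by (metis exchange neg1_neg2)

lemma contrapos2: "x \<leadsto> y = y\<^sup>~ \<rightarrow> x\<^sup>~"
  by (metis exchange neg2_neg1)

lemma odot_le_iff: "x \<odot> y \<preceq> z \<longleftrightarrow> x \<preceq> y \<rightarrow> z"
proof -
  have "x \<odot> y \<preceq> z \<longleftrightarrow> z\<^sup>- \<leadsto> (x \<rightarrow> y\<^sup>-) = \<one>"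
    unfolding le_def odot_def by (metis contrapos1 neg2_neg1)
  also have "\<dots> \<longleftrightarrow> x \<preceq> y \<rightarrow> z"
    unfolding le_def by (metis exchange contrapos1)
  finally show ?thesis .
qed

lemma odot_alt_le_iff: "(y \<leadsto> x\<^sup>~)\<^sup>- \<preceq> z \<longleftrightarrow> x \<preceq> y \<rightarrow> z"
proof -
  have "(y \<leadsto> x\<^sup>~)\<^sup>- \<preceq> z \<longleftrightarrow> z\<^sup>~ \<rightarrow> (y \<leadsto> x\<^sup>~) = \<one>"
    unfolding le_def by (metis contrapos2 neg1_neg2 imp_one_iff)
  also have "\<dots> \<longleftrightarrow> y \<leadsto> (x \<leadsto> z) = \<one>"
    by (metis exchange contrapos2)
  also have "\<dots> \<longleftrightarrow> x \<preceq> y \<rightarrow> z"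
    unfolding le_def by (metis exchange imp_one_iff)
  finally show ?thesis .
qed

lemma odot_alt: "x \<odot> y = (y \<leadsto> x\<^sup>~)\<^sup>-"
  by (metis le_antisym odot_le_iff odot_alt_le_iff le_def imp1_self)

end

locale monadic_bounded_commutative_pseudo_BE = bounded_commutative_pseudo_BE +
  fixes E :: "'a \<Rightarrow> 'a"
    and U :: "'a \<Rightarrow> 'a"
  assumes M1: "x \<rightarrow> E x = \<one>" "x \<leadsto> E x = \<one>"
    and M2: "U x \<rightarrow> x = \<one>" "U x \<leadsto> x = \<one>"
    and M3: "U (x \<rightarrow> E y) = E x \<rightarrow> E y" "U (x \<leadsto> E y) = E x \<leadsto> E y"
    and M4: "U (E x \<rightarrow> y) = E x \<rightarrow> U y" "U (E x \<leadsto> y) = E x \<leadsto> U y"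
    and M5: "E (U x) = U x"
    and M6: "U (x \<odot> x) = U x \<odot> U x"
    and M7: "U (x \<oplus> x) = U x \<oplus> U x"

definition universal_quantifier ::
  "('a \<Rightarrow> 'a \<Rightarrow> 'a) \<Rightarrow> ('a \<Rightarrow> 'a \<Rightarrow> 'a) \<Rightarrow> 'a \<Rightarrow> 'a \<Rightarrow> ('a \<Rightarrow> 'a) \<Rightarrow> bool"
  where "universal_quantifier imp1 imp2 one zero U \<longleftrightarrow>
    (\<exists>E. monadic_bounded_commutative_pseudo_BE imp1 imp2 one zero E U)"

definition existential_quantifier ::
  "('a \<Rightarrow> 'a \<Rightarrow> 'a) \<Rightarrow> ('a \<Rightarrow> 'a \<Rightarrow> 'a) \<Rightarrow> 'a \<Rightarrow> 'a \<Rightarrow> ('a \<Rightarrow> 'a) \<Rightarrow> bool"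
  where "existential_quantifier imp1 imp2 one zero E \<longleftrightarrow>
    (\<exists>U. monadic_bounded_commutative_pseudo_BE imp1 imp2 one zero E U)"

end

theory Submission
  imports Defs
begin

text \<open>Both quantifiers fix \<open>0\<close>: \<open>U 0 \<preceq> 0\<close> by (M2), hence \<open>U 0 = 0\<close>, and then
  \<open>E 0 = E (U 0) = U 0 = 0\<close> by (M5). So the value \<open>y = 0\<close> turns (M3) into the De Morgan laws
  \<open>U (x\<^sup>-) = (E x)\<^sup>-\<close> and \<open>U (x\<^sup>~) = (E x)\<^sup>~\<close>. Since the two negations are mutually inverse, these
  laws can be solved for \<open>E\<close> in terms of \<open>U\<close>, and for \<open>U\<close> in terms of \<open>E\<close>. Hence each member of
  a monadic pair determines the other one, and the relation of being corresponding, which by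
  definition relates every universal quantifier to some existential one and vice versa, is
  the graph of a bijection.\<close>

context monadic_bounded_commutative_pseudo_BE
begin

lemma U_zero: "U \<zero> = \<zero>"
  by (metis M2(1) neg1_neg2 one_imp2)

lemma E_zero: "E \<zero> = \<zero>"
  by (metis M5 U_zero)

lemma U_neg1: "U (x\<^sup>-) = (E x)\<^sup>-"
  using M3(1)[of x \<zero>] by (simp add: E_zero)

lemma U_neg2: "U (x\<^sup>~) = (E x)\<^sup>~"
  using M3(2)[of x \<zero>] by (simp add: E_zero)

lemma E_conv_U: "E x = (U (x\<^sup>-))\<^sup>~" "E x = (U (x\<^sup>~))\<^sup>-"
  by (simp_all add: U_neg1 U_neg2 neg1_neg2 neg2_neg1)

lemma U_conv_E: "U x = (E (x\<^sup>-))\<^sup>~" "U x = (E (x\<^sup>~))\<^sup>-"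
  using U_neg2[of "x\<^sup>-"] U_neg1[of "x\<^sup>~"] by (simp_all add: neg1_neg2 neg2_neg1)

end

theorem theorem4p14:
  fixes imp1 :: "'a \<Rightarrow> 'a \<Rightarrow> 'a"  (infixr \<open>\<rightarrow>\<close> 60)
    and imp2 :: "'a \<Rightarrow> 'a \<Rightarrow> 'a"  (infixr \<open>\<leadsto>\<close> 60)
    and one :: 'a  (\<open>\<one>\<close>)
    and zero :: 'a  (\<open>\<zero>\<close>)
  assumes "bounded_commutative_pseudo_BE (\<rightarrow>) (\<leadsto>) \<one> \<zero>"
  shows "(\<exists>\<phi>. bij_betw \<phi> {U. universal_quantifier (\<rightarrow>) (\<leadsto>) \<one> \<zero> U}
                       {E. existential_quantifier (\<rightarrow>) (\<leadsto>) \<one> \<zero> E} \<and>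
            (\<forall>U E. universal_quantifier (\<rightarrow>) (\<leadsto>) \<one> \<zero> U \<longrightarrow>
              (monadic_bounded_commutative_pseudo_BE (\<rightarrow>) (\<leadsto>) \<one> \<zero> E U \<longleftrightarrow> E = \<phi> U)))
       \<and> (\<forall>U. universal_quantifier (\<rightarrow>) (\<leadsto>) \<one> \<zero> U \<longrightarrow>
            (\<forall>E. monadic_bounded_commutative_pseudo_BE (\<rightarrow>) (\<leadsto>) \<one> \<zero> E U \<longrightarrow>
              (\<forall>x. E x = U (x \<rightarrow> \<zero>) \<leadsto> \<zero> \<and> E x = U (x \<leadsto> \<zero>) \<rightarrow> \<zero>)))
       \<and> (\<forall>E. existential_quantifier (\<rightarrow>) (\<leadsto>) \<one> \<zero> E \<longrightarrow>
            (\<forall>U. monadic_bounded_commutative_pseudo_BE (\<rightarrow>) (\<leadsto>) \<one> \<zero> E U \<longrightarrow>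
              (\<forall>x. U x = E (x \<rightarrow> \<zero>) \<leadsto> \<zero> \<and> U x = E (x \<leadsto> \<zero>) \<rightarrow> \<zero>)))"
proof -
  let ?M = "monadic_bounded_commutative_pseudo_BE (\<rightarrow>) (\<leadsto>) \<one> \<zero>"
  let ?UQ = "universal_quantifier (\<rightarrow>) (\<leadsto>) \<one> \<zero>"
  let ?EQ = "existential_quantifier (\<rightarrow>) (\<leadsto>) \<one> \<zero>"
  define \<phi> where "\<phi> U = (\<lambda>x. U (x \<rightarrow> \<zero>) \<leadsto> \<zero>)" for U
  define \<psi> where "\<psi> E = (\<lambda>x. E (x \<rightarrow> \<zero>) \<leadsto> \<zero>)" for E
  note E_conv = monadic_bounded_commutative_pseudo_BE.E_conv_U
  note U_conv = monadic_bounded_commutative_pseudo_BE.U_conv_E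
  have E_eq: "E = \<phi> U" if "?M E U" for E U
    unfolding \<phi>_def by (rule ext) (rule E_conv(1)[OF that])
  have U_eq: "U = \<psi> E" if "?M E U" for E U
    unfolding \<psi>_def by (rule ext) (rule U_conv(1)[OF that])
  have corr_\<phi>: "?M (\<phi> U) U" if "?UQ U" for U
  proof -
    from that obtain E where "?M E U" unfolding universal_quantifier_def ..
    with E_eq[OF this] show ?thesis by simp
  qed
  have corr_\<psi>: "?M E (\<psi> E)" if "?EQ E" for E
  proof -
    from that obtain U where "?M E U" unfolding existential_quantifier_def ..
    with U_eq[OF this] show ?thesis by simp
  qed
  have bij: "bij_betw \<phi> {U. ?UQ U} {E. ?EQ E}"
  proof (rule bij_betw_byWitness[where f' = \<psi>])
    show "\<forall>U\<in>{U. ?UQ U}. \<psi> (\<phi> U) = U"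
      using U_eq[OF corr_\<phi>] by simp
    show "\<forall>E\<in>{E. ?EQ E}. \<phi> (\<psi> E) = E"
      using E_eq[OF corr_\<psi>] by simp
    show "\<phi> ` {U. ?UQ U} \<subseteq> {E. ?EQ E}"
      using corr_\<phi> by (auto simp: existential_quantifier_def)
    show "\<psi> ` {E. ?EQ E} \<subseteq> {U. ?UQ U}"
      using corr_\<psi> by (auto simp: universal_quantifier_def)
  qed
  have graph: "?M E U \<longleftrightarrow> E = \<phi> U" if "?UQ U" for E U
  proof
    assume "?M E U" then show "E = \<phi> U" by (rule E_eq)
  next
    assume "E = \<phi> U" with corr_\<phi>[OF that] show "?M E U" by simp
  qed
  show ?thesis
  proof (intro conjI exI[of _ \<phi>] allI impI)
  qed (rule bij | erule graph E_conv U_conv)+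
qed

end
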